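(* Let $P=\{010,210\}$. Let $\mathfrak a_{n,m,f}$ be the number of $\sigma\in\mathcal{I}_n(010,210)$ with $\max(\sigma)=m$ and $|\mathbf{Forb}(\sigma,P)|=f$. For $k>0$, let $\mathfrak b_{n,k}$ be the number of words $\omega$ of length $n$ over $\{0,\dots,k\}$ avoiding $010$, such that $\omega_i<\omega_j<k$ implies $i<j$, and such that the letter $k-1$ appears in $\omega$; let $\mathfrak b_{n,0}=1$. Then for all integers $2\leqslant f\leqslant m+1\leqslant n$, $$\mathfrak a_{n,m,f}=\sum_{p=m+1}^{n}\sum_{i=0}^{f-1}\mathfrak b_{n-p,f-i-1}\sum_{j=0}^{m-1}\mathfrak a_{p-1,j,i}.$$
   Context: For $n\in\mathbb N$, an inversion sequence of size $n$ is a sequence $\sigma=(\sigma_1,\dots,\sigma_n)\in\mathbb N^n$ with $\sigma_i<i$ for all $i$. An integer sequence contains a pattern $\rho$ (a finite integer sequence such as $010$ or $210$) if it has a subsequence order-isomorphic to $\rho$, and avoids $\rho$ otherwise. $\mathcal{I}_n(P)$ denotes the set of inversion sequences of size $n$ avoiding every pattern in $P$. $\max(\sigma)$ is the largest entry of $\sigma$ ($-1$ for the empty sequence). For an integer sequence $\alpha$ avoiding the patterns in a set $P$, a value $v\in\{0,\dots,\max(\alpha)\}$ is forbidden by $\alpha$ and $P$ if the sequence $\alpha\cdot(M,v)$ (i.e. $\alpha$ followed by an entry $M$ and then an entry $v$) contains a pattern of $P$ whenever $M>\max(\alpha)$; $\mathbf{Forb}(\alpha,P)$ is the set of such forbidden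 values. *)

theory Defs
  imports Main "HOL-Library.Sublist"
begin

definition order_isomorphic :: "int list \<Rightarrow> int list \<Rightarrow> bool" where
  "order_isomorphic xs ys \<longleftrightarrow> length xs = length ys \<and>
     (\<forall>i<length xs. \<forall>j<length xs. xs ! i < xs ! j \<longleftrightarrow> ys ! i < ys ! j)"

definition contains_pattern :: "int list \<Rightarrow> int list \<Rightarrow> bool" where
  "contains_pattern \<sigma> \<rho> \<longleftrightarrow> (\<exists>\<tau>. subseq \<tau> \<sigma> \<and> order_isomorphic \<tau> \<rho>)"

definition avoids :: "int list \<Rightarrow> int list set \<Rightarrow> bool" where
  "avoids \<sigma> P \<longleftrightarrow> (\<forall>\<rho>\<in>P. \<not> contains_pattern \<sigma> \<rho>)"

(* List positions start at 0, so the condition on the entry at position i + 1 is \<sigma> ! i < i + 1. *)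
definition inversion_seqs :: "nat \<Rightarrow> int list set" where
  "inversion_seqs n = {\<sigma>. length \<sigma> = n \<and> (\<forall>i<n. 0 \<le> \<sigma> ! i \<and> \<sigma> ! i < int (i + 1))}"

definition avoiding_inversion_seqs :: "nat \<Rightarrow> int list set \<Rightarrow> int list set" where
  "avoiding_inversion_seqs n P = {\<sigma> \<in> inversion_seqs n. avoids \<sigma> P}"

definition seq_max :: "int list \<Rightarrow> int" where
  "seq_max \<sigma> = (if \<sigma> = [] then -1 else Max (set \<sigma>))"

definition Forb :: "int list \<Rightarrow> int list set \<Rightarrow> int set" where
  "Forb \<alpha> P = {v \<in> {0..seq_max \<alpha>}. \<forall>M > seq_max \<alpha>. \<exists>\<rho>\<in>P. contains_pattern (\<alpha> @ [M, v]) \<rho>}"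

definition a_count :: "nat \<Rightarrow> nat \<Rightarrow> nat \<Rightarrow> nat" where
  "a_count n m f =
     card {\<sigma> \<in> avoiding_inversion_seqs n {[0,1,0], [2,1,0]}.
             seq_max \<sigma> = int m \<and> card (Forb \<sigma> {[0,1,0], [2,1,0]}) = f}"

definition b_count :: "nat \<Rightarrow> nat \<Rightarrow> nat" where
  "b_count n k =
     (if k = 0 then 1
      else card {\<omega> :: int list.
             length \<omega> = n \<and> set \<omega> \<subseteq> {0..int k} \<and> avoids \<omega> {[0,1,0]} \<and>
             (\<forall>i<n. \<forall>j<n. \<omega> ! i < \<omega> ! j \<and> \<omega> ! j < int k \<longrightarrow> i < j) \<and>
             int k - 1 \<in> set \<omega>})"

end

theory Submission
  imports Defs
begin

text \<open>
  Split an avoiding inversion sequence with maximum m at the first occurrence of m, at position p,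
  as u, m, w. A value is forbidden by u exactly when it occurs in u or lies below the bottom of a
  descent of u. Hence the letters of w other than m are values below m that u does not forbid;
  since each of them follows m, avoiding 210 makes them weakly increasing, and 010 only has to be
  avoided inside w. Those letters are also descent bottoms, so the whole sequence forbids, besides
  what u forbids, the value m and each still allowed value up to the largest letter of w
  below m. If these allowed values number k, then w uses only the k smallest allowed values and m,
  and it does use the k-th; relabelling increasingly by 0, ..., k turns w into a word counted by
  b_count.
\<close>

abbreviation pats :: "int list set" where
  "pats \<equiv> {[0,1,0], [2,1,0]}"

definition no_010 :: "int list \<Rightarrow> bool" where
  "no_010 w \<longleftrightarrow> (\<forall>a b. a < b \<longrightarrow> \<not> subseq [a,b,a] w)"

definition no_210 :: "int list \<Rightarrow> bool" where
  "no_210 w \<longleftrightarrow> (\<forall>a b c. a < b \<and> b < c \<longrightarrow> \<not> subseq [c,b,a] w)"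

text \<open>The order condition on words in \<open>b_count\<close>, phrased with subsequences. It is
  also what avoiding 210 demands of the letters that follow an entry \<open>m\<close>.\<close>

definition mono_below :: "int \<Rightarrow> int list \<Rightarrow> bool" where
  "mono_below m w \<longleftrightarrow> (\<forall>a b. a < b \<and> b < m \<longrightarrow> \<not> subseq [b,a] w)"

section \<open>Subsequences of length two and three\<close>

lemma subseq_set_subset: "subseq v w \<Longrightarrow> set v \<subseteq> set w"
  by (auto simp: subseq_conv_nths dest: in_set_nthsD)

lemma subseq_pair_set: "subseq [x,y] w \<Longrightarrow> x \<in> set w \<and> y \<in> set w"
  by (auto dest!: subseq_set_subset)

lemma subseq_triple_set: "subseq [x,y,z] w \<Longrightarrow> x \<in> set w \<and> y \<in> set w \<and> z \<in> set w"
  by (auto dest!: subseq_set_subset)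

text \<open>The cut between \<open>u\<close> and \<open>w\<close> falls after, between or before the
  two letters. With the three-letter version, this turns a pattern occurrence in a concatenation
  into a case split for the simplifier.\<close>

lemma subseq_pair_append:
  "subseq [x,y] (u @ w) \<longleftrightarrow> subseq [x,y] u \<or> x \<in> set u \<and> y \<in> set w \<or> subseq [x,y] w"
  by (induction u) (auto simp: subseq_singleton_left dest: subseq_pair_set)

lemma subseq_pair_Cons:
  "subseq [x,y] (z # w) \<longleftrightarrow> x = z \<and> y \<in> set w \<or> subseq [x,y] w"
  using subseq_pair_append[of x y "[z]" w] by auto

lemma subseq_triple_append:
  "subseq [x,y,z] (u @ w) \<longleftrightarrow>
     subseq [x,y,z] u \<or> subseq [x,y] u \<and> z \<in> set w \<or> x \<in> set u \<and> subseq [y,z] w \<or> subseq [x,y,z] w"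
  by (induction u) (auto simp: subseq_pair_append subseq_singleton_left dest: subseq_pair_set subseq_triple_set subseq_Cons')

lemma subseq_triple_Cons:
  "subseq [x,y,z] (t # w) \<longleftrightarrow> x = t \<and> subseq [y,z] w \<or> subseq [x,y,z] w"
  using subseq_triple_append[of x y z "[t]" w] by auto

text \<open>Serves to translate the index condition in \<open>b_count\<close> into
  \<open>mono_below\<close>.\<close>

lemma subseq_pair_nth:
  "subseq [x,y] w \<longleftrightarrow> (\<exists>i j. i < j \<and> j < length w \<and> w ! i = x \<and> w ! j = y)"
proof (induction w)
  case (Cons z w)
  have "(\<exists>i j. i < j \<and> j < length (z # w) \<and> (z # w) ! i = x \<and> (z # w) ! j = y) \<longleftrightarrow>
     x = z \<and> (\<exists>j<length w. w ! j = y) \<or> (\<exists>i j. i < j \<and> j < length w \<and> w ! i = x \<and> w ! j = y)"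
    (is "?l \<longleftrightarrow> ?r")
  proof
    assume ?l
    then obtain i j where "i < j" "j < length (z # w)" "(z # w) ! i = x" "(z # w) ! j = y" by blast
    then show ?r by (cases i; cases j) auto
  next
    assume ?r
    then show ?l
    proof (elim disjE conjE exE)
      fix j assume "x = z" "j < length w" "w ! j = y"
      then show ?l by (intro exI[of _ 0] exI[of _ "Suc j"]) auto
    next
      fix i j assume "i < j" "j < length w" "w ! i = x" "w ! j = y"
      then show ?l by (intro exI[of _ "Suc i"] exI[of _ "Suc j"]) auto
    qed
  qed
  with Cons show ?case unfolding subseq_pair_Cons in_set_conv_nth by blast
qed simp

text \<open>These library rules split on equality of letters and would hide the shape needed for
  \<open>subseq_split\<close>.\<close>

declare list_emb_Cons_iff1 [simp del] list_emb_Cons_iff2 [simp del] subseq_Cons2_iff [simp del]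

lemmas subseq_split =
  subseq_pair_append subseq_triple_append subseq_pair_Cons subseq_triple_Cons subseq_singleton_left

lemma subseq_map_iff:
  "subseq xs (map f ys) \<longleftrightarrow> (\<exists>zs. subseq zs ys \<and> xs = map f zs)"
  by (auto simp: subseq_conv_nths nths_map)

section \<open>The two patterns as explicit subsequences\<close>

text \<open>Order isomorphism compares with \<open><\<close> only, but over all ordered pairs of
  positions: as neither outer letter is below the other, they are equal.\<close>

lemma order_isomorphic_010: "order_isomorphic t [0,1,0] \<longleftrightarrow> (\<exists>a b. a < b \<and> t = [a,b,a])"
proof
  assume t: "order_isomorphic t [0,1,0]"
  then obtain x y z where "t = [x,y,z]"
    by (auto simp: order_isomorphic_def length_Suc_conv numeral_3_eq_3)
  with t show "\<exists>a b. a < b \<and> t = [a,b,a]"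
    by (auto simp: order_isomorphic_def numeral_3_eq_3 All_less_Suc2)
qed (auto simp: order_isomorphic_def numeral_3_eq_3 less_Suc_eq)

lemma order_isomorphic_210:
  "order_isomorphic t [2,1,0] \<longleftrightarrow> (\<exists>a b c. a < b \<and> b < c \<and> t = [c,b,a])"
proof
  assume t: "order_isomorphic t [2,1,0]"
  then obtain x y z where "t = [x,y,z]"
    by (auto simp: order_isomorphic_def length_Suc_conv numeral_3_eq_3)
  with t show "\<exists>a b c. a < b \<and> b < c \<and> t = [c,b,a]"
    by (auto simp: order_isomorphic_def numeral_3_eq_3 All_less_Suc2)
qed (auto simp: order_isomorphic_def numeral_3_eq_3 less_Suc_eq)

lemma avoids_010_iff: "avoids w {[0,1,0]} \<longleftrightarrow> no_010 w"
  by (auto simp: avoids_def contains_pattern_def order_isomorphic_010 no_010_def)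

lemma avoids_pats_iff: "avoids w pats \<longleftrightarrow> no_010 w \<and> no_210 w"
  unfolding avoids_def contains_pattern_def no_010_def no_210_def
  by (simp add: order_isomorphic_010 order_isomorphic_210) blast

section \<open>Maxima and forbidden values\<close>

lemma le_seq_max: "x \<in> set w \<Longrightarrow> x \<le> seq_max w"
  by (auto simp: seq_max_def)

lemma seq_max_less_iff: "0 \<le> m \<Longrightarrow> seq_max w < m \<longleftrightarrow> (\<forall>x\<in>set w. x < m)"
  by (auto simp: seq_max_def)

lemma seq_max_eq_iff: "0 \<le> m \<Longrightarrow> seq_max w = m \<longleftrightarrow> m \<in> set w \<and> (\<forall>x\<in>set w. x \<le> m)"
  by (auto simp: seq_max_def Max_eq_iff)

text \<open>As \<open>M\<close> exceeds every entry of \<open>w\<close> and only \<open>v\<close>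
  follows it, \<open>M\<close> can occur in a pattern only as the 1 of 010, and then
  \<open>v\<close> already occurs in \<open>w\<close>. A new 210 must end in \<open>v\<close>, with
  its first two letters a descent of \<open>w\<close>.\<close>

lemma Forb_iff:
  assumes "avoids w pats"
  shows "v \<in> Forb w pats \<longleftrightarrow> 0 \<le> v \<and> v \<le> seq_max w \<and>
    (v \<in> set w \<or> (\<exists>b c. v < b \<and> b < c \<and> subseq [c,b] w))"
proof -
  have w: "\<not> subseq [a,b,a] w" if "a < b" for a b
    using assms that by (auto simp: avoids_pats_iff no_010_def)
  have w': "\<not> subseq [c,b,a] w" if "a < b" "b < c" for a b c
    using assms that by (auto simp: avoids_pats_iff no_210_def)
  have "(\<exists>\<rho>\<in>pats. contains_pattern (w @ [M, v]) \<rho>) \<longleftrightarrow>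
      v \<in> set w \<or> (\<exists>b c. v < b \<and> b < c \<and> subseq [c,b] w)" (is "?l \<longleftrightarrow> ?r")
    if M: "seq_max w < M" and v: "v \<le> seq_max w" for M
  proof -
    have lt: "x < M" if "x \<in> set w" for x
      using le_seq_max[OF that] M by simp
    have "?l \<longleftrightarrow> \<not> no_010 (w @ [M,v]) \<or> \<not> no_210 (w @ [M,v])"
      using avoids_pats_iff[of "w @ [M,v]"] by (auto simp: avoids_def)
    also have "\<dots> \<longleftrightarrow> ?r"
    proof
      assume "\<not> no_010 (w @ [M,v]) \<or> \<not> no_210 (w @ [M,v])"
      then show ?r
      proof
        assume "\<not> no_010 (w @ [M,v])"
        then obtain a b where ab: "a < b" "subseq [a,b,a] (w @ [M,v])" by (auto simp: no_010_def)
        then have "b \<in> set w \<or> b = M \<or> b = v" using subseq_triple_set[OF ab(2)] by auto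
        \<comment> \<open>Hence \<open>a < M\<close>, so \<open>M\<close> can only be the middle
          letter.\<close>
        then have "b \<le> M" using M v lt[of b] by linarith
        with ab consider "subseq [a,b,a] w" | "a \<in> set w" "a = v"
          by (auto simp: subseq_split dest: subseq_pair_set)
        then show ?r using w ab by cases blast+
      next
        assume "\<not> no_210 (w @ [M,v])"
        then obtain a b c where abc: "a < b" "b < c" "subseq [c,b,a] (w @ [M,v])"
          by (auto simp: no_210_def)
        then have "c \<in> set w \<or> c = M \<or> c = v" using subseq_triple_set[OF abc(3)] by auto
        then have "c \<le> M" using M v lt[of c] by linarith
        with abc consider "subseq [c,b,a] w" | "subseq [c,b] w" "a = v"
          by (auto simp: subseq_split)
        then show ?r using w' abc by cases blast+
      qed
    next
      assume ?r
      then show "\<not> no_010 (w @ [M,v]) \<or> \<not> no_210 (w @ [M,v])"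
      proof
        assume "v \<in> set w"
        then have "subseq [v,M,v] (w @ [M,v])" by (simp add: subseq_split)
        then show ?thesis using M v by (force simp: no_010_def)
      next
        assume "\<exists>b c. v < b \<and> b < c \<and> subseq [c,b] w"
        then obtain b c where "v < b" "b < c" "subseq [c,b,v] (w @ [M,v])"
          by (auto simp: subseq_split)
        then show ?thesis by (auto simp: no_210_def)
      qed
    qed
    finally show ?thesis .
  qed
  then show ?thesis
    unfolding Forb_def using lt_ex gt_ex[of "seq_max w"] by auto
qed

lemma Forb_subset: "Forb w P \<subseteq> {0..seq_max w}"
  by (auto simp: Forb_def)

section \<open>Splitting at the first occurrence of the maximum\<close>

context
  fixes u w :: "int list" and m :: int
  assumes u: "\<forall>x\<in>set u. 0 \<le> x \<and> x < m" and w: "set w \<subseteq> {0..m}"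
begin

text \<open>A letter of \<open>w\<close> follows \<open>m\<close> just as \<open>v\<close> follows
  \<open>M\<close> in the definition of \<open>Forb\<close>. Conversely, an occurrence of 010 lies
  in \<open>u\<close>, lies in \<open>w\<close>, or has its outer value in both; an occurrence of
  210 lies in \<open>u\<close>, has a descent in \<open>u\<close> above a letter of
  \<open>w\<close>, or ends in a descent of \<open>w\<close> among letters below
  \<open>m\<close>.\<close>

lemma avoids_append_max:
  "avoids (u @ m # w) pats \<longleftrightarrow>
     avoids u pats \<and> set w \<inter> Forb u pats = {} \<and> no_010 w \<and> mono_below m w" (is "?l \<longleftrightarrow> ?r")
proof
  assume l: ?l
  have n1: "\<not> subseq [a,b,a] (u @ m # w)" if "a < b" for a b
    using l that by (auto simp: avoids_pats_iff no_010_def)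
  have n2: "\<not> subseq [c,b,a] (u @ m # w)" if "a < b" "b < c" for a b c
    using l that by (auto simp: avoids_pats_iff no_210_def)
  have u': "avoids u pats"
    using n1 n2 by (auto simp: avoids_pats_iff no_010_def no_210_def subseq_split)
  moreover have "v \<notin> Forb u pats" if "v \<in> set w" for v
    using u n1[of v m] n2[of v] that
    by (auto simp: Forb_iff[OF u'] subseq_split)
  moreover have "no_010 w"
    using n1 by (auto simp: no_010_def subseq_split)
  moreover have "mono_below m w"
    using n2 by (auto simp: mono_below_def subseq_split)
  ultimately show ?r by blast
next
  assume r: ?r
  then have u': "avoids u pats" by blast
  have nF: "v \<notin> set u" "v < b \<Longrightarrow> b < c \<Longrightarrow> \<not> subseq [c,b] u" if "v \<in> set w" for v b c
  proof -
    have "v \<notin> Forb u pats" "0 \<le> v" using that r w by auto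
    then have *: "\<not> (v \<le> seq_max u \<and> (v \<in> set u \<or> (\<exists>b c. v < b \<and> b < c \<and> subseq [c,b] u)))"
      using Forb_iff[OF u'] by blast
    then show "v \<notin> set u" using le_seq_max[of v u] by blast
    show "\<not> subseq [c,b] u" if "v < b" "b < c"
    proof
      assume s: "subseq [c,b] u"
      then have "b \<le> seq_max u" using subseq_pair_set[OF s] le_seq_max[of b u] by blast
      with that(1) have "v \<le> seq_max u" by simp
      with that s * show False by blast
    qed
  qed
  have wm: "x \<le> m" if "x \<in> set w" for x using w that by auto
  have um: "x < m" if "x \<in> set u" for x using u that by auto
  have "\<not> subseq [a,b,a] (u @ m # w)" if "a < b" for a b
  proof
    assume s: "subseq [a,b,a] (u @ m # w)"
    then have "b \<in> set u \<or> b = m \<or> b \<in> set w" using subseq_triple_set[OF s] by auto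
    then have "b \<le> m" using um[of b] wm[of b] by linarith
    \<comment> \<open>So the \<open>m\<close> between \<open>u\<close> and \<open>w\<close> can only
      serve as the middle letter.\<close>
    with that have "a < m" by simp
    with s consider "subseq [a,b,a] u" | "a \<in> set u" "a \<in> set w" | "subseq [a,b,a] w"
      by (auto simp: subseq_split dest: subseq_pair_set)
    moreover have "\<not> subseq [a,b,a] u" "\<not> subseq [a,b,a] w"
      using u' r that by (auto simp: avoids_pats_iff no_010_def)
    ultimately show False using nF(1) by cases blast+
  qed
  moreover have "\<not> subseq [c,b,a] (u @ m # w)" if "a < b" "b < c" for a b c
  proof
    assume s: "subseq [c,b,a] (u @ m # w)"
    then have "c \<in> set u \<or> c = m \<or> c \<in> set w" using subseq_triple_set[OF s] by auto
    then have "c \<le> m" using um[of c] wm[of c] by linarith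
    with that have lt: "a < m" "b < m" by simp_all
    with s consider "subseq [c,b,a] u" | "subseq [c,b] u" "a \<in> set w" | "subseq [b,a] w"
      by (auto simp: subseq_split dest: subseq_Cons')
    moreover have "\<not> subseq [c,b,a] u" "\<not> subseq [b,a] w"
      using u' r that lt by (auto simp: avoids_pats_iff no_210_def mono_below_def)
    ultimately show False using nF(2) that by cases blast+
  qed
  ultimately show ?l by (auto simp: avoids_pats_iff no_010_def no_210_def)
qed

text \<open>Each letter \<open>l < m\<close> of \<open>w\<close> forms a descent with the preceding
  \<open>m\<close>, so \<open>l\<close> and everything below it become forbidden. Other descents
  that end in \<open>w\<close> have such an \<open>l\<close> as their bottom too and add
  nothing.\<close>

lemma Forb_append_max:
  assumes a: "avoids (u @ m # w) pats" and "0 \<le> m"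
  shows "Forb (u @ m # w) pats =
    Forb u pats \<union> {m} \<union> {v \<in> {0..<m} - Forb u pats. \<exists>l\<in>set w \<inter> ({0..<m} - Forb u pats). v \<le> l}"
proof -
  have u': "avoids u pats" and d: "set w \<inter> Forb u pats = {}"
    using a by (simp_all add: avoids_append_max)
  have sm: "seq_max (u @ m # w) = m"
    using u w \<open>0 \<le> m\<close> by (subst seq_max_eq_iff) force+
  have su: "seq_max u < m" using u \<open>0 \<le> m\<close> by (simp add: seq_max_less_iff)
  show ?thesis
  proof (intro equalityI subsetI)
    fix v assume v: "v \<in> Forb (u @ m # w) pats"
    then have v0: "0 \<le> v" "v \<le> m" by (simp_all add: Forb_iff[OF a] sm)
    from v consider "v \<in> set u" | "v = m" | "v \<in> set w"
      | b c where "v < b" "b < c" "subseq [c,b] (u @ m # w)"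
      by (auto simp: Forb_iff[OF a])
    then show "v \<in> Forb u pats \<union> {m} \<union>
      {v \<in> {0..<m} - Forb u pats. \<exists>l\<in>set w \<inter> ({0..<m} - Forb u pats). v \<le> l}"
    proof cases
      case 1
      then show ?thesis using v0 le_seq_max by (auto simp: Forb_iff[OF u'])
    next
      case 3
      then show ?thesis using v0 d by force
    next
      case 4
      \<comment> \<open>The cases locate the bottom \<open>b\<close> of the descent. The last one is
        impossible, since entries of \<open>u\<close> are below \<open>m\<close>.\<close>
      then consider "subseq [c,b] u" | "b \<in> set w" "b < m" | "b = m" "c \<in> set u"
        using u w subseq_pair_set[of c b w]
        by (fastforce simp: subseq_split)
      then show ?thesis
      proof cases
        case 1
        then have "v \<le> seq_max u" using 4 le_seq_max[of b u] subseq_pair_set by fastforce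
        then show ?thesis using 1 4 v0 by (auto simp: Forb_iff[OF u'])
      next
        case 2
        then have "b \<in> set w \<inter> ({0..<m} - Forb u pats)" "v \<le> b" using 4 d w by auto
        then show ?thesis using v0 by fastforce
      next
        case 3
        then show ?thesis using 4 u by force
      qed
    qed simp
  next
    fix v assume "v \<in> Forb u pats \<union> {m} \<union>
      {v \<in> {0..<m} - Forb u pats. \<exists>l\<in>set w \<inter> ({0..<m} - Forb u pats). v \<le> l}"
    then consider "v \<in> Forb u pats" | "v = m" | l where "l \<in> set w" "0 \<le> v" "v \<le> l" "l < m"
      by auto
    then show "v \<in> Forb (u @ m # w) pats"
    proof cases
      case 1
      then show ?thesis using su
        by (auto simp: Forb_iff[OF u'] Forb_iff[OF a] sm subseq_split)
    next
      case 2
      then show ?thesis using \<open>0 \<le> m\<close> by (simp add: Forb_iff[OF a] sm)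
    next
      case 3
      then show ?thesis
        by (cases "v = l") (auto simp: Forb_iff[OF a] sm subseq_split)
    qed
  qed
qed

end

section \<open>Increasing relabelling and the words counted by \<open>b_count\<close>\<close>

text \<open>Both properties depend only on the relative order of the letters, and the second also on
  their order relative to \<open>k\<close>, which is why \<open>k\<close> must lie in
  \<open>A\<close> there.\<close>

lemma strict_mono_on_relabel:
  fixes \<phi> :: "int \<Rightarrow> int"
  assumes \<phi>: "strict_mono_on A \<phi>" and w: "set w \<subseteq> A"
  shows "no_010 (map \<phi> w) \<longleftrightarrow> no_010 w"
    and "k \<in> A \<Longrightarrow> mono_below (\<phi> k) (map \<phi> w) \<longleftrightarrow> mono_below k w"
proof -
  have less: "\<phi> x < \<phi> y \<longleftrightarrow> x < y" and eq: "\<phi> x = \<phi> y \<longleftrightarrow> x = y" if "x \<in> A" "y \<in> A" for x y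
    using strict_mono_on_less[OF \<phi> that] inj_on_eq_iff[OF strict_mono_on_imp_inj_on[OF \<phi>] that]
    by (simp_all only:)
  show "no_010 (map \<phi> w) \<longleftrightarrow> no_010 w"
  proof
    assume l: "no_010 (map \<phi> w)"
    show "no_010 w"
      unfolding no_010_def
    proof (intro allI impI notI)
      fix a b assume ab: "a < b" "subseq [a,b,a] w"
      then have "a \<in> A" "b \<in> A" using subseq_triple_set[OF ab(2)] w by auto
      moreover have "subseq [\<phi> a, \<phi> b, \<phi> a] (map \<phi> w)" using subseq_map[OF ab(2), of \<phi>] by simp
      moreover have "\<phi> a < \<phi> b" using ab less calculation by blast
      ultimately show False using l by (auto simp: no_010_def)
    qed
  next
    assume r: "no_010 w"
    show "no_010 (map \<phi> w)"
      unfolding no_010_def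
    proof (intro allI impI notI)
      fix a b assume ab: "a < b" "subseq [a,b,a] (map \<phi> w)"
      then obtain x y z where xyz: "subseq [x,y,z] w" "\<phi> x = a" "\<phi> y = b" "\<phi> z = a"
        unfolding subseq_map_iff by (auto simp: Cons_eq_map_conv)
      then have "x \<in> A" "y \<in> A" "z \<in> A" using subseq_triple_set[OF xyz(1)] w by auto
      then have "x < y" "z = x" using xyz ab less eq by blast+
      then show False using r xyz by (auto simp: no_010_def)
    qed
  qed
  show "mono_below (\<phi> k) (map \<phi> w) \<longleftrightarrow> mono_below k w" if k: "k \<in> A"
  proof
    assume l: "mono_below (\<phi> k) (map \<phi> w)"
    show "mono_below k w"
      unfolding mono_below_def
    proof (intro allI impI notI)
      fix a b assume ab: "a < b \<and> b < k" "subseq [b,a] w"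
      then have "a \<in> A" "b \<in> A" using subseq_pair_set[OF ab(2)] w by auto
      moreover have "subseq [\<phi> b, \<phi> a] (map \<phi> w)" using subseq_map[OF ab(2), of \<phi>] by simp
      moreover have "\<phi> a < \<phi> b" "\<phi> b < \<phi> k" using ab less k calculation by blast+
      ultimately show False using l by (auto simp: mono_below_def)
    qed
  next
    assume r: "mono_below k w"
    show "mono_below (\<phi> k) (map \<phi> w)"
      unfolding mono_below_def
    proof (intro allI impI notI)
      fix a b assume ab: "a < b \<and> b < \<phi> k" "subseq [b,a] (map \<phi> w)"
      then obtain x y where xy: "subseq [y,x] w" "\<phi> x = a" "\<phi> y = b"
        by (auto simp: subseq_map_iff Cons_eq_map_conv)
      then have "x \<in> A" "y \<in> A" using subseq_pair_set[OF xy(1)] w by auto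
      then have "x < y" "y < k" using xy ab less k by blast+
      then show False using r xy by (auto simp: mono_below_def)
    qed
  qed
qed

text \<open>The guard on the last clause absorbs the convention \<open>b_count n 0 = 1\<close>: for
  \<open>k = 0\<close> the only word is \<open>replicate n 0\<close>.\<close>

definition b_words :: "nat \<Rightarrow> nat \<Rightarrow> int list set" where
  "b_words n k = {w. length w = n \<and> set w \<subseteq> {0..int k} \<and> no_010 w \<and> mono_below (int k) w \<and>
     (0 < k \<longrightarrow> int k - 1 \<in> set w)}"

lemma b_count_eq_card: "b_count n k = card (b_words n k)"
proof (cases "k = 0")
  case True
  have "w \<in> b_words n 0 \<longleftrightarrow> w = replicate n 0" for w
  proof
    assume "w \<in> b_words n 0"
    then show "w = replicate n 0" by (auto simp: b_words_def intro!: replicate_eqI)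
  next
    assume w: "w = replicate n 0"
    have "no_010 w" unfolding no_010_def w using subseq_triple_set[of _ _ _ "replicate n 0"] by fastforce
    moreover have "mono_below 0 w" unfolding mono_below_def w
      using subseq_pair_set[of _ _ "replicate n 0"] by fastforce
    ultimately show "w \<in> b_words n 0" using w by (auto simp: b_words_def)
  qed
  then have "b_words n 0 = {replicate n 0}" by blast
  then show ?thesis using True by (simp add: b_count_def)
next
  case False
  have "(\<forall>i<length w. \<forall>j<length w. w ! i < w ! j \<and> w ! j < int k \<longrightarrow> i < j) \<longleftrightarrow> mono_below (int k) w"
    (is "?l \<longleftrightarrow> ?r") for w
  proof
    assume ?l
    then show ?r unfolding mono_below_def subseq_pair_nth
      by (metis order.asym order.strict_trans)
  next
    assume r: ?r
    show ?l
    proof (intro allI impI, elim conjE)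
      fix i j assume ij: "i < length w" "j < length w" "w ! i < w ! j" "w ! j < int k"
      then have "\<not> j < i" "i \<noteq> j" using r unfolding mono_below_def subseq_pair_nth by blast+
      then show "i < j" by simp
    qed
  qed
  then show ?thesis using False
    unfolding b_count_def b_words_def avoids_010_iff
    by (auto intro!: arg_cong[where f = card])
qed

text \<open>Here V plays the role of the values below m that the prefix does not forbid.\<close>

definition tails :: "int set \<Rightarrow> int \<Rightarrow> nat \<Rightarrow> nat \<Rightarrow> int list set" where
  "tails V m q k = {w. length w = q \<and> set w \<subseteq> insert m V \<and> no_010 w \<and> mono_below m w \<and>
     card {v \<in> V. \<exists>l\<in>set w \<inter> V. v \<le> l} = k}"

text \<open>The cardinality condition in \<open>tails\<close> says that the largest letter of the
  word in \<open>V\<close> is the \<open>k\<close>-th smallest element of \<open>V\<close>.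
  Relabelling \<open>0, ..., k - 1\<close> by the \<open>k\<close> smallest elements and
  \<open>k\<close> by \<open>m\<close> therefore matches the words of \<open>b_words\<close> with
  the tails.\<close>

lemma card_tails:
  assumes V: "finite V" "\<forall>v\<in>V. v < m" and k: "k \<le> card V"
  shows "card (tails V m q k) = b_count q k"
proof -
  \<comment> \<open>\<open>h r\<close> is the element of \<open>V\<close> with exactly
    \<open>r\<close> smaller ones, so the \<open>k\<close>-th smallest is
    \<open>h (k - 1)\<close>.\<close>
  define h where "h = (!) (sorted_list_of_set V)"
  have h: "bij_betw h {..<card V} V" "strict_mono_on {..<card V} h"
    unfolding h_def using V(1)
    by (auto intro!: bij_betw_nth strict_mono_onI
        sorted_wrt_nth_less[OF strict_sorted_list_of_set])
  \<comment> \<open>The top letter goes to \<open>m\<close> even when \<open>V\<close> has more than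
    \<open>k\<close> elements; \<open>\<phi>\<close> stays increasing because \<open>m\<close>
    exceeds all of \<open>V\<close>.\<close>
  define \<phi> where "\<phi> x = (if x = int k then m else h (nat x))" for x
  have hV: "h r \<in> V" if "r < card V" for r using h(1) that by (auto simp: bij_betw_def)
  have Vh: "\<exists>r<card V. v = h r" if "v \<in> V" for v using h(1) that by (auto simp: bij_betw_def)
  have hle: "h r \<le> h s \<longleftrightarrow> r \<le> s" if "r < card V" "s < card V" for r s
    using strict_mono_on_less_eq[OF h(2)] that by blast
  have \<phi>: "strict_mono_on {0..int k} \<phi>"
  proof (rule strict_mono_onI)
    fix r s :: int assume rs: "r \<in> {0..int k}" "s \<in> {0..int k}" "r < s"
    then have r: "nat r < card V" "nat r < nat s" "\<phi> r = h (nat r)" using k by (auto simp: \<phi>_def)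
    show "\<phi> r < \<phi> s"
    proof (cases "s = int k")
      case True
      then show ?thesis using r hV V(2) by (simp add: \<phi>_def)
    next
      case False
      then have "nat s < card V" using rs k by auto
      then show ?thesis using r h(2) False by (auto simp: \<phi>_def strict_mono_on_def)
    qed
  qed
  have \<phi>_img: "\<phi> ` {0..int k} = insert m (h ` {..<k})"
  proof -
    have "{0..int k} = insert (int k) (int ` {..<k})"
      by (auto simp: image_iff) (metis lessThan_iff nat_less_iff nat_0_le order_less_le)
    moreover have "\<phi> ` int ` {..<k} = h ` {..<k}"
      unfolding image_image by (rule image_cong) (auto simp: \<phi>_def)
    moreover have "\<phi> (int k) = m" by (simp add: \<phi>_def)
    ultimately show ?thesis by (simp only: image_insert)
  qed
  have key: "set w \<subseteq> insert m V \<and> card {v \<in> V. \<exists>l\<in>set w \<inter> V. v \<le> l} = k \<longleftrightarrow>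
      set w \<subseteq> insert m (h ` {..<k}) \<and> (0 < k \<longrightarrow> h (k - 1) \<in> set w)" (is "?l \<longleftrightarrow> ?r") for w
  proof -
    \<comment> \<open>If the largest letter in \<open>V\<close> has index \<open>r\<close>, the set
      counted is the image of \<open>{..r}\<close> under \<open>h\<close>.\<close>
    have low: "card {v \<in> V. \<exists>l\<in>set w \<inter> V. v \<le> l} = Suc r"
      if r: "r < card V" "h r \<in> set w" "\<forall>l\<in>set w \<inter> V. l \<le> h r" for r
    proof -
      have "{v \<in> V. \<exists>l\<in>set w \<inter> V. v \<le> l} = {v \<in> V. v \<le> h r}"
        using r(2,3) hV[OF r(1)] by (auto intro: order_trans)
      also have "\<dots> = h ` {..r}"
      proof (intro equalityI subsetI)
        fix v assume v: "v \<in> {v \<in> V. v \<le> h r}"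
        then obtain s where s: "s < card V" "v = h s" using Vh by blast
        then have "s \<le> r" using v hle[OF s(1) r(1)] by simp
        then show "v \<in> h ` {..r}" using s by blast
      next
        fix v assume "v \<in> h ` {..r}"
        then obtain s where s: "s \<le> r" "v = h s" by blast
        then have "s < card V" using r(1) by simp
        then show "v \<in> {v \<in> V. v \<le> h r}" using s hV hle[OF _ r(1)] by simp
      qed
      finally have "card {v \<in> V. \<exists>l\<in>set w \<inter> V. v \<le> l} = card (h ` {..r})" by simp
      moreover have "{..r} \<subseteq> {..<card V}" using r(1) by auto
      then have "inj_on h {..r}" using h(1) by (auto simp: bij_betw_def intro: inj_on_subset)
      ultimately show ?thesis by (simp add: card_image)
    qed
    show ?thesis
    proof
      assume l: ?l
      show ?r
      proof (cases "set w \<inter> V = {}")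
        case True
        then show ?thesis using l by auto
      next
        case False
        then have "Max (set w \<inter> V) \<in> set w \<inter> V" by (intro Max_in) auto
        then obtain r where r: "r < card V" "Max (set w \<inter> V) = h r" "h r \<in> set w"
          using Vh by fastforce
        have mx: "\<forall>l\<in>set w \<inter> V. l \<le> h r" using r(2)[symmetric] by auto
        have kr: "k = Suc r" using low[OF r(1,3) mx] l by simp
        have "x \<in> insert m (h ` {..<k})" if x: "x \<in> set w" for x
        proof (cases "x = m")
          case False
          then have xV: "x \<in> V" using l x by auto
          then obtain s where s: "s < card V" "x = h s" using Vh by blast
          then have "s \<le> r" using mx x xV hle r(1) by blast
          then show ?thesis using s kr by auto
        qed simp
        then show ?thesis using r kr by auto
      qed
    next
      assume r: ?r
      have sub: "h ` {..<k} \<subseteq> V" using hV k by auto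
      show ?l
      proof (cases "k = 0")
        case True
        then have "set w \<inter> V = {}" using r V by auto
        then show ?thesis using True r by auto
      next
        case False
        have "\<forall>l\<in>set w \<inter> V. l \<le> h (k - 1)"
        proof
          fix l assume "l \<in> set w \<inter> V"
          then obtain s where "s < k" "l = h s" using r V by auto
          then show "l \<le> h (k - 1)" using hle k by auto
        qed
        then have "card {v \<in> V. \<exists>l\<in>set w \<inter> V. v \<le> l} = Suc (k - 1)"
          using low[of "k - 1"] r False k by auto
        then show ?thesis using False r sub by auto
      qed
    qed
  qed
  have "tails V m q k = {w. length w = q \<and> set w \<subseteq> \<phi> ` {0..int k} \<and> no_010 w \<and>
      mono_below (\<phi> (int k)) w \<and> (0 < k \<longrightarrow> h (k - 1) \<in> set w)}"
    unfolding tails_def \<phi>_img using key by (auto simp: \<phi>_def)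
  also have "\<dots> = map \<phi> ` b_words q k"
  proof -
    have last: "h (k - 1) \<in> set (map \<phi> w) \<longleftrightarrow> int k - 1 \<in> set w" if "set w \<subseteq> {0..int k}" "0 < k" for w
    proof -
      have "h (k - 1) = \<phi> (int k - 1)" using that by (simp add: \<phi>_def nat_diff_distrib)
      then show ?thesis
        using inj_on_image_mem_iff[OF strict_mono_on_imp_inj_on[OF \<phi>] _ that(1), of "int k - 1"] that(2)
        by simp
    qed
    have "w \<in> map \<phi> ` b_words q k" if "length w = q" "set w \<subseteq> \<phi> ` {0..int k}" "no_010 w"
      "mono_below (\<phi> (int k)) w" "0 < k \<longrightarrow> h (k - 1) \<in> set w" for w
    proof -
      have "w \<in> map \<phi> ` lists {0..int k}" using that(2) unfolding lists_image[symmetric] by auto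
      then obtain w' where w': "w = map \<phi> w'" "set w' \<subseteq> {0..int k}"
        by (auto simp: in_lists_conv_set)
      have "int k \<in> {0..int k}" by simp
      then have "w' \<in> b_words q k"
        using that(1,3,4,5) w'(2) strict_mono_on_relabel[OF \<phi> w'(2)] last[OF w'(2)]
        unfolding b_words_def w'(1) by simp
      then show ?thesis using w' by blast
    qed
    moreover have "length (map \<phi> w) = q \<and> set (map \<phi> w) \<subseteq> \<phi> ` {0..int k} \<and> no_010 (map \<phi> w) \<and>
      mono_below (\<phi> (int k)) (map \<phi> w) \<and> (0 < k \<longrightarrow> h (k - 1) \<in> set (map \<phi> w))"
      if "w \<in> b_words q k" for w
    proof -
      have w: "set w \<subseteq> {0..int k}" using that by (simp add: b_words_def)
      have "int k \<in> {0..int k}" by simp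
      moreover have "set (map \<phi> w) \<subseteq> \<phi> ` {0..int k}" using w by auto
      ultimately show ?thesis using that strict_mono_on_relabel[OF \<phi> w] last[OF w]
        unfolding b_words_def by simp
    qed
    ultimately show ?thesis by blast
  qed
  finally have "tails V m q k = map \<phi> ` b_words q k" .
  moreover have "b_words q k \<subseteq> lists {0..int k}" by (auto simp: b_words_def)
  then have "inj_on (map \<phi>) (b_words q k)"
    using inj_on_map_lists[OF strict_mono_on_imp_inj_on[OF \<phi>]] inj_on_subset by blast
  ultimately show ?thesis by (simp add: card_image b_count_eq_card)
qed

section \<open>Decomposition of avoiding inversion sequences\<close>

text \<open>The entry \<open>m\<close> has index \<open>length u\<close>, counted from 0, whence
  \<open>m \<le> int (length u)\<close>. Later entries are at most \<open>m\<close>, so they satisfy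
  the inversion bound automatically.\<close>

lemma inversion_seqs_append_max:
  assumes m: "0 \<le> m"
  shows "u @ m # w \<in> inversion_seqs n \<and> seq_max (u @ m # w) = m \<and> m \<notin> set u \<longleftrightarrow>
    u \<in> inversion_seqs (length u) \<and> (\<forall>x\<in>set u. 0 \<le> x \<and> x < m) \<and> set w \<subseteq> {0..m} \<and>
    m \<le> int (length u) \<and> n = Suc (length u + length w)" (is "?l \<longleftrightarrow> ?r")
proof
  assume l: ?l
  then have len: "n = Suc (length u + length w)" by (simp add: inversion_seqs_def)
  have nth: "0 \<le> (u @ m # w) ! i" "(u @ m # w) ! i \<le> int i" if "i < n" for i
    using l that by (auto simp: inversion_seqs_def)
  have "u \<in> inversion_seqs (length u)"
    unfolding inversion_seqs_def
  proof (intro CollectI conjI refl allI impI)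
    fix i assume "i < length u"
    then show "0 \<le> u ! i" "u ! i < int (i + 1)"
      using nth[of i] len by (simp_all add: nth_append)
  qed
  moreover have "length u < n" using len by simp
  from nth(2)[OF this] have "m \<le> int (length u)" by simp
  moreover have nonneg: "0 \<le> x" if "x \<in> set (u @ m # w)" for x
  proof -
    obtain i where i: "i < length (u @ m # w)" "x = (u @ m # w) ! i"
      using \<open>x \<in> _\<close> unfolding in_set_conv_nth by blast
    then have "i < n" using len by simp
    from nth(1)[OF this] show ?thesis using i(2) by simp
  qed
  moreover have le: "x \<le> m" if "x \<in> set (u @ m # w)" for x
    using le_seq_max[OF that] l by simp
  moreover have "x < m" if "x \<in> set u" for x
    using le[of x] that l by (cases "x = m") auto
  ultimately show ?r using len by auto
next
  assume r: ?r
  have "0 \<le> (u @ m # w) ! i \<and> (u @ m # w) ! i < int (i + 1)" if "i < n" for i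
  proof -
    consider "i < length u" | "i = length u" | "length u < i" by linarith
    then show ?thesis
    proof cases
      case 1
      then show ?thesis using r by (auto simp: inversion_seqs_def nth_append)
    next
      case 2
      then show ?thesis using r m by simp
    next
      case 3
      then obtain d where d: "i = Suc (length u + d)" using less_natE by blast
      then have "w ! d \<in> set w" using r \<open>i < n\<close> by simp
      then have "w ! d \<in> {0..m}" using r by blast
      then show ?thesis using r d by (simp add: nth_append)
    qed
  qed
  then have "u @ m # w \<in> inversion_seqs n" using r
    unfolding inversion_seqs_def by simp
  moreover have "\<forall>x\<in>set u \<union> set w. x \<le> m" using r by (auto simp: order_less_imp_le)
  then have "seq_max (u @ m # w) = m" using m by (simp add: seq_max_eq_iff ball_Un)
  ultimately show ?l using r by auto
qed

definition a_seqs :: "nat \<Rightarrow> nat \<Rightarrow> nat \<Rightarrow> int list set" where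
  "a_seqs n m f = {\<sigma> \<in> avoiding_inversion_seqs n pats. seq_max \<sigma> = int m \<and> card (Forb \<sigma> pats) = f}"

lemma finite_a_seqs: "finite (a_seqs n m f)"
proof (rule finite_subset)
  show "a_seqs n m f \<subseteq> {w. set w \<subseteq> {0..int n} \<and> length w = n}"
  proof
    fix w assume "w \<in> a_seqs n m f"
    then have w: "length w = n" "\<And>i. i < n \<Longrightarrow> 0 \<le> w ! i \<and> w ! i < int (i + 1)"
      by (auto simp: a_seqs_def avoiding_inversion_seqs_def inversion_seqs_def)
    have "set w \<subseteq> {0..int n}"
    proof
      fix x assume "x \<in> set w"
      then obtain i where "i < n" "x = w ! i" using w(1) by (auto simp: in_set_conv_nth)
      then show "x \<in> {0..int n}" using w(2)[of i] by auto
    qed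
    with w(1) show "w \<in> {w. set w \<subseteq> {0..int n} \<and> length w = n}" by blast
  qed
qed (simp add: finite_lists_length_eq)

lemma finite_tails: "finite V \<Longrightarrow> finite (tails V m q k)"
  by (rule finite_subset[OF _ finite_lists_length_eq[of "insert m V" q]]) (auto simp: tails_def)

text \<open>The forbidden values of the whole sequence are those of \<open>u\<close>, the value
  \<open>m\<close>, and the new ones below \<open>m\<close>, a disjoint union. Hence
  \<open>w\<close> contributes \<open>f - card (Forb u pats) - 1\<close> values, and
  \<open>card (Forb u pats) < f\<close> keeps this subtraction exact.\<close>

lemma append_max_in_a_seqs_iff:
  "u @ int m # w \<in> a_seqs n m f \<and> int m \<notin> set u \<longleftrightarrow>
     u \<in> avoiding_inversion_seqs (length u) pats \<and> seq_max u < int m \<and> m \<le> length u \<and>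
     n = Suc (length u + length w) \<and> card (Forb u pats) < f \<and>
     w \<in> tails ({0..<int m} - Forb u pats) (int m) (length w) (f - card (Forb u pats) - 1)"
    (is "?l \<longleftrightarrow> ?r")
proof -
  define V where "V = {0..<int m} - Forb u pats"
  \<comment> \<open>These are the values below \<open>m\<close> that become forbidden only through
    \<open>w\<close>.\<close>
  define D where "D = {v \<in> V. \<exists>l\<in>set w \<inter> V. v \<le> l}"
  define B where "B \<longleftrightarrow> u \<in> inversion_seqs (length u) \<and> (\<forall>x\<in>set u. 0 \<le> x \<and> x < int m) \<and>
    set w \<subseteq> {0..int m} \<and> m \<le> length u \<and> n = Suc (length u + length w)"
  have "?l \<longleftrightarrow> B \<and> avoids (u @ int m # w) pats \<and> card (Forb (u @ int m # w) pats) = f"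
    using inversion_seqs_append_max[of "int m" u w n]
    by (auto simp: a_seqs_def avoiding_inversion_seqs_def B_def)
  also have "\<dots> \<longleftrightarrow> B \<and> avoids (u @ int m # w) pats \<and> card (Forb u pats) < f \<and>
      card D = f - card (Forb u pats) - 1"
  proof (rule conj_cong[OF refl], rule conj_cong[OF refl])
    assume B: B and a: "avoids (u @ int m # w) pats"
    then have u: "\<forall>x\<in>set u. 0 \<le> x \<and> x < int m" and w: "set w \<subseteq> {0..int m}" by (simp_all add: B_def)
    have F: "Forb u pats \<subseteq> {0..<int m}"
      using Forb_subset[of u pats] u seq_max_less_iff[of "int m" u] by fastforce
    have "Forb (u @ int m # w) pats = insert (int m) (Forb u pats \<union> D)"
      using Forb_append_max[OF u w a] by (simp add: D_def V_def)
    moreover have "int m \<notin> Forb u pats \<union> D" using F by (auto simp: D_def V_def)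
    moreover have "finite (Forb u pats)" using F finite_subset by blast
    moreover have "finite D" unfolding D_def V_def by (rule finite_subset[of _ "{0..<int m}"]) auto
    moreover have "Forb u pats \<inter> D = {}" by (auto simp: D_def V_def)
    ultimately have "card (Forb (u @ int m # w) pats) = Suc (card (Forb u pats) + card D)"
      by (simp add: card_Un_disjoint)
    then show "card (Forb (u @ int m # w) pats) = f \<longleftrightarrow>
        card (Forb u pats) < f \<and> card D = f - card (Forb u pats) - 1"
      by auto
  qed
  also have "\<dots> \<longleftrightarrow> ?r"
  proof -
    have B_iff: "B \<longleftrightarrow> u \<in> inversion_seqs (length u) \<and> seq_max u < int m \<and>
        set w \<subseteq> {0..int m} \<and> m \<le> length u \<and> n = Suc (length u + length w)"
      unfolding B_def seq_max_less_iff[of "int m" u, OF of_nat_0_le_iff]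
      by (auto simp: inversion_seqs_def in_set_conv_nth)
    have t: "w \<in> tails V (int m) (length w) k \<longleftrightarrow>
        set w \<subseteq> {0..int m} \<and> set w \<inter> Forb u pats = {} \<and> no_010 w \<and> mono_below (int m) w \<and> card D = k"
      if "seq_max u < int m" for k
    proof -
      have "int m \<notin> Forb u pats" using Forb_subset[of u pats] that by auto
      then have "set w \<subseteq> insert (int m) V \<longleftrightarrow> set w \<subseteq> {0..int m} \<and> set w \<inter> Forb u pats = {}"
        by (fastforce simp: V_def)
      then show ?thesis unfolding tails_def D_def by blast
    qed
    have a: "avoids (u @ int m # w) pats \<longleftrightarrow>
       avoids u pats \<and> set w \<inter> Forb u pats = {} \<and> no_010 w \<and> mono_below (int m) w" if B
      using that avoids_append_max[of u "int m" w] by (simp add: B_def)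
    show ?thesis
    proof (cases B)
      case True
      then have "seq_max u < int m" by (simp add: B_iff)
      with True show ?thesis
        using a[OF True] t unfolding V_def[symmetric] avoiding_inversion_seqs_def B_iff
        by (simp add: conj_ac)
    next
      case False
      then show ?thesis
        using t unfolding V_def[symmetric] avoiding_inversion_seqs_def B_iff by auto
    qed
  qed
  finally show ?thesis .
qed

lemma append_Cons_first_eq:
  assumes "u @ x # w = u' @ x # w'" "x \<notin> set u" "x \<notin> set u'"
  shows "u = u' \<and> w = w'"
  using assms
proof (induction u arbitrary: u')
  case Nil
  then show ?case by (cases u') auto
next
  case (Cons a u)
  then show ?case by (cases u') auto
qed

text \<open>Here \<open>p\<close> is the position of the first \<open>m\<close>, counted from 1,
  \<open>i\<close> the number of values forbidden by the prefix \<open>u\<close>, and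
  \<open>j\<close> the maximum of \<open>u\<close>. All three are determined by \<open>u\<close>,
  and cutting at the first \<open>m\<close> is unique, which gives injectivity.\<close>

lemma a_seqs_decomposition:
  assumes "0 < m"
  shows "bij_betw (\<lambda>(p,i,j,u,w). u @ int m # w)
    (SIGMA p:{m + 1..n}. SIGMA i:{0..<f}. SIGMA j:{0..<m}. SIGMA u:a_seqs (p - 1) j i.
      tails ({0..<int m} - Forb u pats) (int m) (n - p) (f - i - 1))
    (a_seqs n m f)" (is "bij_betw ?g ?T _")
proof -
  have T: "u @ int m # w \<in> a_seqs n m f \<and> int m \<notin> set u \<and> p = Suc (length u) \<and>
      i = card (Forb u pats) \<and> int j = seq_max u"
    if "(p,i,j,u,w) \<in> ?T" for p i j u w
  proof -
    have *: "m + 1 \<le> p" "p \<le> n" "i < f" "j < m" "u \<in> a_seqs (p - 1) j i"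
      "w \<in> tails ({0..<int m} - Forb u pats) (int m) (n - p) (f - i - 1)"
      using that by auto
    then have "length u = p - 1" "length w = n - p"
      by (auto simp: a_seqs_def avoiding_inversion_seqs_def inversion_seqs_def tails_def)
    with * show ?thesis
      using append_max_in_a_seqs_iff[of u m w n f] by (auto simp: a_seqs_def)
  qed
  have "inj_on ?g ?T"
  proof (rule inj_onI)
    fix s s' assume s: "s \<in> ?T" "s' \<in> ?T" "?g s = ?g s'"
    obtain p i j u w where x: "s = (p,i,j,u,w)" by (cases s)
    obtain p' i' j' u' w' where y: "s' = (p',i',j',u',w')" by (cases s')
    note Tx = T[OF s(1)[unfolded x]] and Ty = T[OF s(2)[unfolded y]]
    have e: "u @ int m # w = u' @ int m # w'" using s(3) by (simp add: x y)
    have uw: "u = u' \<and> w = w'" using append_Cons_first_eq[OF e] Tx Ty by blast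
    then have "int j = int j'" using Tx Ty by simp
    then show "s = s'" using uw Tx Ty by (simp add: x y)
  qed
  have sup: "s \<in> ?g ` ?T" if s: "s \<in> a_seqs n m f" for s
  proof -
    have "int m \<in> set s" using s seq_max_eq_iff[of "int m" s] by (simp add: a_seqs_def)
    then obtain u w where uw: "s = u @ int m # w" "int m \<notin> set u" using split_list_first by metis
    then have r: "u \<in> avoiding_inversion_seqs (length u) pats" "seq_max u < int m" "m \<le> length u"
      "n = Suc (length u + length w)" "card (Forb u pats) < f"
      "w \<in> tails ({0..<int m} - Forb u pats) (int m) (length w) (f - card (Forb u pats) - 1)"
      using append_max_in_a_seqs_iff[of u m w n f] s by simp_all
    \<comment> \<open>An empty prefix would have maximum -1, which no natural number
      \<open>j\<close> represents.\<close>
    have "u \<noteq> []" using r(3) assms by auto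
    then have "hd u \<in> set u" by simp
    moreover have "0 \<le> x" if "x \<in> set u" for x
      using r(1) that by (auto simp: avoiding_inversion_seqs_def inversion_seqs_def in_set_conv_nth)
    ultimately have "0 \<le> seq_max u" using le_seq_max[of "hd u" u] order_trans by blast
    then obtain j where j: "seq_max u = int j" using nonneg_int_cases by blast
    have "(Suc (length u), card (Forb u pats), j, u, w) \<in> ?T"
      using r j by (auto simp: a_seqs_def)
    then show ?thesis by (rule rev_image_eqI) (simp add: uw)
  qed
  have sub: "?g x \<in> a_seqs n m f" if "x \<in> ?T" for x
  proof -
    obtain p i j u w where x: "x = (p,i,j,u,w)" by (cases x)
    show ?thesis using T[OF that[unfolded x]] by (simp add: x)
  qed
  have "?g ` ?T = a_seqs n m f"
    by (intro equalityI image_subsetI subsetI) (rule sub sup, assumption)+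
  with \<open>inj_on ?g ?T\<close> show ?thesis by (rule bij_betw_imageI)
qed

section \<open>Summation over the decomposition\<close>

theorem theorem20:
  fixes n m f :: nat
  assumes "2 \<le> f" and "f \<le> m + 1" and "m + 1 \<le> n"
  shows "a_count n m f =
    (\<Sum>p = m + 1..n. \<Sum>i = 0..f - 1.
       b_count (n - p) (f - i - 1) * (\<Sum>j = 0..m - 1. a_count (p - 1) j i))"
proof -
  have m: "0 < m" using assms by simp
  define V where "V u = {0..<int m} - Forb u pats" for u
  \<comment> \<open>The number of tails depends on \<open>u\<close> only through \<open>i\<close>:
    there are \<open>m - i\<close> allowed values below \<open>m\<close>, and
    \<open>f \<le> m + 1\<close> ensures that \<open>f - i - 1\<close> does not exceed this
    number.\<close>
  have tl: "card (tails (V u) (int m) (n - p) (f - i - 1)) = b_count (n - p) (f - i - 1)"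
    if "u \<in> a_seqs (p - 1) j i" "j < m" for u p i j
  proof -
    have u: "seq_max u = int j" "card (Forb u pats) = i" using that by (simp_all add: a_seqs_def)
    then have F: "Forb u pats \<subseteq> {0..<int m}" using Forb_subset[of u pats] that(2) by auto
    then have "card (V u) = m - i"
      unfolding V_def using u by (simp add: card_Diff_subset finite_subset[OF F])
    then show ?thesis using assms by (intro card_tails) (auto simp: V_def)
  qed
  have fin: "finite (tails (V u) (int m) q k)" for u q k by (simp add: finite_tails V_def)
  have "a_count n m f = card (a_seqs n m f)" by (simp add: a_count_def a_seqs_def)
  also have "\<dots> = (\<Sum>p = m + 1..n. \<Sum>i = 0..<f. \<Sum>j = 0..<m. \<Sum>u\<in>a_seqs (p - 1) j i.
      card (tails (V u) (int m) (n - p) (f - i - 1)))"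
    unfolding bij_betw_same_card[OF a_seqs_decomposition[OF m, of n f], symmetric] V_def[symmetric]
    by (simp add: card_SigmaI finite_SigmaI finite_a_seqs fin)
  also have "\<dots> = (\<Sum>p = m + 1..n. \<Sum>i = 0..<f. \<Sum>j = 0..<m.
      b_count (n - p) (f - i - 1) * a_count (p - 1) j i)"
  proof (intro sum.cong refl)
    fix p i j assume "j \<in> {0..<m}"
    then have "(\<Sum>u\<in>a_seqs (p - 1) j i. card (tails (V u) (int m) (n - p) (f - i - 1))) =
        (\<Sum>u\<in>a_seqs (p - 1) j i. b_count (n - p) (f - i - 1))"
      by (intro sum.cong refl tl) simp_all
    then show "(\<Sum>u\<in>a_seqs (p - 1) j i. card (tails (V u) (int m) (n - p) (f - i - 1))) =
        b_count (n - p) (f - i - 1) * a_count (p - 1) j i"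
      by (simp add: a_count_def a_seqs_def)
  qed
  also have "\<dots> = (\<Sum>p = m + 1..n. \<Sum>i = 0..f - 1.
      b_count (n - p) (f - i - 1) * (\<Sum>j = 0..m - 1. a_count (p - 1) j i))"
  proof -
    \<comment> \<open>Positivity of \<open>f\<close> and \<open>m\<close> matters here: at 0,
      truncated subtraction would make the right-hand sides \<open>{0..0}\<close>.\<close>
    have "{0..<f} = {0..f - 1}" "{0..<m} = {0..m - 1}" using assms m by auto
    then show ?thesis by (simp only: sum_distrib_left)
  qed
  finally show ?thesis .
qed

end
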